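(* Let $N\ge 2$ and let $\rho$ be an absolutely continuous probability measure on $\mathbb{R}^d$. For $m=1,\dots,N$ let $T^m(r,\theta)=(F^m(r,\theta),\theta)$ be the map of $\mathbb{R}^d$ described in the context. Then $T^m$ pushes $\rho$ forward to itself, i.e. $(T^m)_{\#}\rho=\rho$.
   Context: Polar-like coordinates: neglecting the origin, $\mathbb{R}^d$ is identified with $\mathbb{R}\times\mathbb{P}^{d-1}$ ($\mathbb{P}^{d-1}$ is real projective space, the set of lines through the origin): after (measurably) choosing a unit direction vector on each line $\theta$, $(r,\theta)$ denotes the point at signed distance $r$ from the origin on the line $\theta$. Let $d\theta$ be the uniform measure on $\mathbb{P}^{d-1}$, and write $\rho=\rho(r,\theta)\,dr\,d\theta$ in these coordinates, so $\int_{\mathbb{P}^{d-1}}\int_{\mathbb{R}}\rho(r,\theta)\,dr\,d\theta=1$. One-dimensional construction. Let $\sigma$ be an absolutely continuous finite measure on $\mathbb{R}$ of total mass $M>0$. Set $r^0=-\infty$, $r^i=\inf\{t:\sigma((r^{i-1},t))\ge \frac{M}{N}\}$ for $i=1,\dots,N-1$, $r^N=+\infty$, and $I^i=[r^{i-1},r^i]$ (intersected with $\mathbb{R}$), so $\sigma(I^i)=M/N$. For $m,j\in\{1,\dots,N\}$, let $k\in\{1,\dots,N\}$ with $k\equiv m+j-1\pmod N$; then $F^m$ maps $I^j$ to $I^k$ and is defined ($\sigma$-almost everywhere) for $t\in I^j$ by $\sigma((r^{k-1},F^m(t)))=\sigma((r^{j-1},t))$. For almost every $\theta$ (with $\int_{\mathbb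 R}\rho(r,\theta)dr>0$), $r\mapsto F^m(r,\theta)$ denotes the map $F^m$ of the one-dimensional construction applied to $\sigma=\rho(r,\theta)\,dr$. *)

theory Defs
  imports "HOL-Probability.Probability"
begin

section \<open>Real projective space and its uniform measure\<close>

definition lines :: "'a::euclidean_space set set" where
  "lines = {L. subspace L \<and> dim L = 1}"

text \<open>The sigma-algebra on the set of lines is the quotient one: a set of lines is measurable iff
  the corresponding cone, without its apex, is a Borel set.\<close>

definition line_algebra :: "'a::euclidean_space set measure" where
  "line_algebra = sigma lines {A. A \<subseteq> lines \<and> {x. x \<noteq> 0 \<and> span {x} \<in> A} \<in> sets borel}"

text \<open>The law of the line through a uniformly distributed random point of the punctured unit ball.
  As the ball and Lebesgue measure are rotation invariant, this is the rotation invariant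
  probability measure.\<close>

definition uniform_lines :: "'a::euclidean_space set measure" where
  "uniform_lines =
     distr (restrict_space (uniform_measure lborel (ball 0 1)) (- {0})) line_algebra (\<lambda>x. span {x})"

lemma space_line_algebra [simp]: "space line_algebra = lines"
  unfolding line_algebra_def by (rule space_measure_of) auto

lemma sets_line_algebra:
  "sets (line_algebra :: 'a::euclidean_space set measure) =
     {A. A \<subseteq> lines \<and> {x. x \<noteq> 0 \<and> span {x} \<in> A} \<in> sets borel}"
proof -
  let ?\<A> = "{A. A \<subseteq> lines \<and> {x::'a. x \<noteq> 0 \<and> span {x} \<in> A} \<in> sets borel}"
  have line: "span {x} \<in> lines" if "x \<noteq> 0" for x :: 'a
    using that dim_eq_card_independent[of "{x}"] by (auto simp: lines_def)
  have "sigma_algebra lines ?\<A>"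
  proof (subst sigma_algebra_iff2, intro conjI ballI allI impI)
    fix A assume A: "A \<in> ?\<A>"
    have "{x::'a. x \<noteq> 0 \<and> span {x} \<in> lines - A} = (- {0}) - {x. x \<noteq> 0 \<and> span {x} \<in> A}"
      using line by auto
    then show "lines - A \<in> ?\<A>"
      using A by auto
  next
    fix A :: "nat \<Rightarrow> 'a set set" assume A: "range A \<subseteq> ?\<A>"
    have "{x::'a. x \<noteq> 0 \<and> span {x} \<in> (\<Union>i. A i)} = (\<Union>i. {x. x \<noteq> 0 \<and> span {x} \<in> A i})"
      by auto
    moreover have "\<And>i. {x. x \<noteq> 0 \<and> span {x} \<in> A i} \<in> sets borel"
      using A by auto
    ultimately show "(\<Union>i. A i) \<in> ?\<A>"
      using A by auto
  qed auto
  then show ?thesis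
    unfolding line_algebra_def by (simp add: sigma_algebra.sets_measure_of_eq)
qed

lemma sets_uniform_lines [measurable_cong, simp]: "sets uniform_lines = sets line_algebra"
  by (simp add: uniform_lines_def)

lemma span_measurable:
  "(\<lambda>x. span {x}) \<in> restrict_space borel (- {0}) \<rightarrow>\<^sub>M (line_algebra :: 'a::euclidean_space set measure)"
proof (rule measurableI)
  fix x :: 'a assume "x \<in> space (restrict_space borel (- {0}))"
  then show "span {x} \<in> space line_algebra"
    using dim_eq_card_independent[of "{x}"] by (auto simp: lines_def space_restrict_space)
next
  fix A :: "'a set set" assume "A \<in> sets line_algebra"
  then have "{x. x \<noteq> 0 \<and> span {x} \<in> A} \<in> sets borel"
    by (simp add: sets_line_algebra)
  moreover have "(\<lambda>x. span {x}) -` A \<inter> space (restrict_space borel (- {0}))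
      = {x. x \<noteq> 0 \<and> span {x} \<in> A}"
    by (auto simp: space_restrict_space)
  ultimately show "(\<lambda>x. span {x}) -` A \<inter> space (restrict_space borel (- {0}))
      \<in> sets (restrict_space borel (- {0}))"
    by (auto simp: sets_restrict_space_iff)
qed

lemma prob_space_uniform_lines: "prob_space (uniform_lines :: 'a::euclidean_space set measure)"
proof -
  let ?U = "uniform_measure lborel (ball (0::'a) 1)"
  have fin: "emeasure lborel (ball (0::'a) 1) \<noteq> \<infinity>"
    using emeasure_lborel_ball_finite[of "0::'a" 1] by simp
  have pos: "emeasure lborel (ball (0::'a) 1) \<noteq> 0"
    using content_ball_pos[of 1 "0::'a"] by (auto simp: measure_def)
  interpret U: prob_space ?U
    by (rule prob_space_uniform_measure) (use fin pos in auto)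
  have "emeasure ?U {0} = 0"
  proof -
    have "ball 0 1 \<inter> {0} = {0::'a}" by auto
    then show ?thesis
      by (simp add: emeasure_lborel_countable)
  qed
  then have "emeasure ?U (- {0}) = 1"
    using U.emeasure_space_1 emeasure_Diff[of ?U "{0}" UNIV] by (simp add: Compl_eq_Diff_UNIV)
  then have "prob_space (restrict_space ?U (- {0}))"
    by (intro prob_spaceI) (simp add: emeasure_restrict_space space_restrict_space)
  moreover have "(\<lambda>x. span {x}) \<in> restrict_space ?U (- {0}) \<rightarrow>\<^sub>M line_algebra"
    by (subst measurable_cong_sets[OF sets_restrict_space_cong refl, of _ borel])
      (simp_all add: span_measurable)
  ultimately show ?thesis
    unfolding uniform_lines_def by (rule prob_space.prob_space_distr)
qed

section \<open>Polar-like coordinates\<close>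

definition direction_choice :: "('a::euclidean_space set \<Rightarrow> 'a) \<Rightarrow> bool" where
  "direction_choice u \<longleftrightarrow>
     u \<in> line_algebra \<rightarrow>\<^sub>M borel \<and> (\<forall>\<theta>\<in>lines. u \<theta> \<in> \<theta> \<and> norm (u \<theta>) = 1)"

text \<open>\<open>g\<close> is a density of \<open>\<rho>\<close> with respect to \<open>dr d\<theta>\<close>; the Jacobian factor \<open>\<bar>r\<bar> ^ (d - 1)\<close>
  is thus part of \<open>g\<close>.\<close>

definition polar_density ::
  "('a::euclidean_space set \<Rightarrow> 'a) \<Rightarrow> 'a measure \<Rightarrow> (real \<times> 'a set \<Rightarrow> ennreal) \<Rightarrow> bool" where
  "polar_density u \<rho> g \<longleftrightarrow>
     g \<in> borel_measurable (lborel \<Otimes>\<^sub>M uniform_lines) \<and>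
     distr (density (lborel \<Otimes>\<^sub>M uniform_lines) g) borel (\<lambda>(r, \<theta>). r *\<^sub>R u \<theta>) = \<rho>"

section \<open>The one-dimensional construction\<close>

fun cut :: "real measure \<Rightarrow> nat \<Rightarrow> nat \<Rightarrow> ereal" where
  "cut \<sigma> N 0 = -\<infinity>"
| "cut \<sigma> N (Suc i) =
     (if Suc i < N
      then Inf (ereal ` {t. measure \<sigma> (einterval (cut \<sigma> N i) (ereal t)) \<ge> measure \<sigma> UNIV / real N})
      else \<infinity>)"

definition piece :: "real measure \<Rightarrow> nat \<Rightarrow> nat \<Rightarrow> real set" where
  "piece \<sigma> N i = {t. cut \<sigma> N (i - 1) \<le> ereal t \<and> ereal t \<le> cut \<sigma> N i}"

text \<open>The defining equation has a unique solution only up to a \<open>\<sigma>\<close>-null set, so the map is described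
  by a predicate.\<close>

definition cyclic_map :: "real measure \<Rightarrow> nat \<Rightarrow> nat \<Rightarrow> (real \<Rightarrow> real) \<Rightarrow> bool" where
  "cyclic_map \<sigma> N m F \<longleftrightarrow>
     (\<forall>j\<in>{1..N}. \<forall>k\<in>{1..N}. k mod N = (m + j - 1) mod N \<longrightarrow>
        (AE t in \<sigma>. t \<in> piece \<sigma> N j \<longrightarrow>
           F t \<in> piece \<sigma> N k \<and>
           measure \<sigma> (einterval (cut \<sigma> N (k - 1)) (ereal (F t))) =
           measure \<sigma> (einterval (cut \<sigma> N (j - 1)) (ereal t))))"

section \<open>The map on the whole space\<close>

text \<open>\<open>T\<close> is, off the origin, the map \<open>(r, \<theta>) \<mapsto> (F (r, \<theta>), \<theta>)\<close>. Since the maps \<open>F (\<cdot>, \<theta>)\<close> are only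
  determined almost everywhere on almost every line, \<open>F\<close> is taken jointly measurable.\<close>

definition line_cyclic_map ::
  "('a::euclidean_space set \<Rightarrow> 'a) \<Rightarrow> 'a measure \<Rightarrow> nat \<Rightarrow> nat \<Rightarrow> ('a \<Rightarrow> 'a) \<Rightarrow> bool" where
  "line_cyclic_map u \<rho> N m T \<longleftrightarrow>
     (\<exists>g F. polar_density u \<rho> g \<and>
        F \<in> borel_measurable (lborel \<Otimes>\<^sub>M uniform_lines) \<and>
        (AE \<theta> in uniform_lines. (\<integral>\<^sup>+ r. g (r, \<theta>) \<partial>lborel) > 0 \<longrightarrow>
           cyclic_map (density lborel (\<lambda>r. g (r, \<theta>))) N m (\<lambda>r. F (r, \<theta>))) \<and>
        (\<forall>\<theta>\<in>lines. \<forall>r. r \<noteq> 0 \<longrightarrow> T (r *\<^sub>R u \<theta>) = F (r, \<theta>) *\<^sub>R u \<theta>))"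

end

theory Submission
  imports Defs
begin

text \<open>On a line carrying a finite measure \<open>\<sigma>\<close> without atoms, the distribution function of \<open>\<sigma>\<close>
  pushes \<open>\<sigma>\<close> forward to Lebesgue measure on \<open>[0, M]\<close> and turns \<open>F\<^sup>m\<close> into the rotation by
  \<open>(m - 1) M / N\<close> of the circle of length \<open>M\<close>. So \<open>F\<^sup>m\<close> preserves \<open>\<sigma>\<close>, and it exists, being
  the quantile function applied to the rotated distribution function. Integrating over the lines gives
  the invariance of \<open>\<rho>\<close>. The density of \<open>\<rho>\<close> in polar-like coordinates comes from the
  Radon-Nikodym theorem.\<close>

section \<open>Rotating an atomless measure on the line\<close>

text \<open>The offset is \<open>m - 1\<close> because \<open>m\<close> counts from 1: for
  \<open>m = 1\<close> every piece is sent to itself. The map is determined only up to null sets, so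
  it is handled through the equation \<open>cdf \<sigma> (F t) = rotate ... (cdf \<sigma> t)\<close>
  almost everywhere. The distribution function may be constant on intervals and so need not be
  injective, but each level set is null; this disposes of the end points of pieces and of every
  ambiguity in inverting it. Two obstacles remain in passing from one line to the whole space.
  Radon-Nikodym requires that the coordinates of Lebesgue almost every point avoid a given null set
  for dr d\<theta>; since the uniform measure on lines is the law of the line through a random point
  of a ball, this is a Fubini argument. The maps on different lines must also fit together
  measurably, although a quantile is an infimum over an uncountable set; the equivalence of
  \<open>quantile \<sigma> s \<le> x\<close> and \<open>s \<le> cdf \<sigma> x\<close> removes the
  infimum.\<close>

definition quantile :: "real measure \<Rightarrow> real \<Rightarrow> real" where
  "quantile \<sigma> s = Inf {x. s \<le> cdf \<sigma> x}"

text \<open>\<open>M\<close> is the length of the circle and \<open>b\<close> the angle. For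
  \<open>s\<close> and \<open>b\<close> in [0, M] a single subtraction of \<open>M\<close> replaces
  reduction modulo \<open>M\<close>.\<close>

definition rotate :: "real \<Rightarrow> real \<Rightarrow> real \<Rightarrow> real" where
  "rotate M b s = (if s + b < M then s + b else s + b - M)"

lemma rotate_measurable [measurable]:
  assumes [measurable]: "f \<in> borel_measurable N" "g \<in> borel_measurable N" "h \<in> borel_measurable N"
  shows "(\<lambda>x. rotate (f x) (g x) (h x)) \<in> borel_measurable N"
  unfolding rotate_def by measurable

text \<open>Pieces are numbered from 1, so the residue class of 0 is represented by \<open>N\<close>
  rather than by 0.\<close>

lemma ex_mod_eq_atLeastAtMost:
  fixes n N :: nat
  assumes "0 < N"
  shows "\<exists>k\<in>{1..N}. k mod N = n mod N"
proof (cases "n mod N = 0")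
  case True
  then show ?thesis using assms by (intro bexI[of _ N]) auto
next
  case False
  then show ?thesis using assms by (intro bexI[of _ "n mod N"]) (auto simp: less_imp_le)
qed

section \<open>Distribution function and quantiles of an atomless measure\<close>

locale atomless_real_measure = finite_borel_measure \<sigma> for \<sigma> :: "real measure" +
  assumes atomless: "measure \<sigma> {x} = 0"
begin

abbreviation mass :: real where "mass \<equiv> measure \<sigma> UNIV"

lemma sets_borel [simp, measurable_cong]: "sets \<sigma> = sets borel"
  by (rule M_is_borel)

lemma space_UNIV [simp]: "space \<sigma> = UNIV"
  by (rule borel_UNIV)

lemma cdf_le_mass: "cdf \<sigma> x \<le> mass"
  using cdf_bounded by simp

lemma isCont_cdf_atomless: "isCont (cdf \<sigma>) x"
  by (simp add: isCont_cdf atomless)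

lemma cdf_measurable [measurable]: "cdf \<sigma> \<in> borel_measurable borel"
  by (intro borel_measurable_continuous_onI continuous_at_imp_continuous_on) (simp add: isCont_cdf_atomless)

lemma measure_lessThan: "measure \<sigma> {..<x} = cdf \<sigma> x"
proof -
  have "cdf \<sigma> x = measure \<sigma> {..<x} + measure \<sigma> {x}"
    unfolding cdf_def ivl_disj_un(2)[symmetric] by (subst finite_measure_Union) auto
  then show ?thesis
    by (simp add: atomless)
qed

lemma measure_Ioo:
  assumes "x \<le> y"
  shows "measure \<sigma> {x<..<y} = cdf \<sigma> y - cdf \<sigma> x"
proof (cases "x = y")
  case False
  with assms have "{x<..y} = {x<..<y} \<union> {y}" by auto
  also have "measure \<sigma> \<dots> = measure \<sigma> {x<..<y} + measure \<sigma> {y}"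
    by (intro finite_measure_Union) auto
  finally have "measure \<sigma> {x<..y} = measure \<sigma> {x<..<y} + measure \<sigma> {y}" .
  then show ?thesis
    using cdf_diff_eq[of x y] False assms by (simp add: atomless)
qed simp

context
  fixes s :: real
  assumes s: "0 < s" "s < mass"
begin

text \<open>Continuity of the distribution function makes the superlevel set closed, so its infimum
  is attained, and the intermediate value theorem yields a point of level exactly \<open>s\<close>.
  The end levels are excluded: at 0 the set is the whole line, and at \<open>mass\<close> it may be
  empty.\<close>

lemma quantile_least:
  "{x. s \<le> cdf \<sigma> x} = {quantile \<sigma> s..}" "cdf \<sigma> (quantile \<sigma> s) = s"
proof -
  let ?S = "{x. s \<le> cdf \<sigma> x}"
  obtain x where x: "cdf \<sigma> x > s"
    using order_tendstoD(1)[OF cdf_lim_at_top, of s] s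
    by (auto simp: eventually_at_top_linorder)
  obtain y where y: "cdf \<sigma> y < s"
    using order_tendstoD(2)[OF cdf_lim_at_bot, of s] s
    by (auto simp: eventually_at_bot_linorder)
  have yx: "y \<le> x"
    using x y cdf_nondecreasing[of x y] by linarith
  have ne: "?S \<noteq> {}" using x less_imp_le by blast
  have below: "y \<le> z" if "z \<in> ?S" for z
    using that y cdf_nondecreasing[of z y] by force
  have bdd: "bdd_below ?S"
    using below by (auto simp: bdd_below_def)
  have "closed ?S"
    by (intro closed_Collect_le continuous_at_imp_continuous_on) (simp_all add: isCont_cdf_atomless)
  then have mem: "quantile \<sigma> s \<in> ?S"
    unfolding quantile_def using closed_contains_Inf[OF ne bdd] by simp
  show "?S = {quantile \<sigma> s..}"
  proof (intro set_eqI iffI)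
    fix z assume "z \<in> ?S"
    then show "z \<in> {quantile \<sigma> s..}"
      unfolding quantile_def using cInf_lower[OF _ bdd] by simp
  next
    fix z assume "z \<in> {quantile \<sigma> s..}"
    then show "z \<in> ?S"
      using mem cdf_nondecreasing[of "quantile \<sigma> s" z] by simp
  qed
  obtain z where z: "cdf \<sigma> z = s"
    using IVT[of "cdf \<sigma>" y s x] x y yx by (auto simp: isCont_cdf_atomless)
  then have "quantile \<sigma> s \<le> z"
    using \<open>?S = {quantile \<sigma> s..}\<close> by auto
  then show "cdf \<sigma> (quantile \<sigma> s) = s"
    using z mem cdf_nondecreasing[of "quantile \<sigma> s" z] by auto
qed

lemma quantile_le_iff: "quantile \<sigma> s \<le> x \<longleftrightarrow> s \<le> cdf \<sigma> x"
  using quantile_least(1) by auto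

end

text \<open>The law of \<open>cdf \<sigma>\<close> under \<sigma> is Lebesgue measure on [0, mass]:
  for inner levels the set is a half-line ending at the quantile, whose own level is
  \<open>c\<close>.\<close>

lemma measure_cdf_less:
  assumes "0 \<le> c" "c \<le> mass"
  shows "measure \<sigma> {t. cdf \<sigma> t < c} = c"
proof -
  have *: "measure \<sigma> {t. cdf \<sigma> t < c} = c" if c: "0 < c" "c < mass" for c
  proof -
    have "{t. cdf \<sigma> t < c} = - {t. c \<le> cdf \<sigma> t}" by auto
    also have "\<dots> = {..<quantile \<sigma> c}"
      using quantile_least(1)[OF c] by auto
    finally show ?thesis
      using quantile_least(2)[OF c] by (simp add: measure_lessThan)
  qed
  consider "c = 0" | "0 < c" "c < mass" | "0 < c" "c = mass"
    using assms by fastforce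
  then show ?thesis
  proof cases
    case 1
    then have "{t. cdf \<sigma> t < c} = {}"
      using cdf_nonneg by (auto simp: not_less)
    then show ?thesis using 1 by simp
  next
    \<comment> \<open>The level \<open>mass\<close> need not be attained, so it is approached by
      smaller levels.\<close>
    case 3
    have "measure \<sigma> {t. cdf \<sigma> t < c} \<le> c"
      unfolding 3 by (intro finite_measure_mono) auto
    moreover have "c \<le> measure \<sigma> {t. cdf \<sigma> t < c}"
    proof (rule dense_le_bounded[OF \<open>0 < c\<close>])
      fix w assume w: "0 < w" "w < c"
      have "w = measure \<sigma> {t. cdf \<sigma> t < w}"
        using *[of w] w 3 by simp
      also have "\<dots> \<le> measure \<sigma> {t. cdf \<sigma> t < c}"
        using w by (intro finite_measure_mono) auto
      finally show "w \<le> measure \<sigma> {t. cdf \<sigma> t < c}" .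
    qed
    ultimately show ?thesis by simp
  qed (use * in auto)
qed

lemma measure_cdf_atLeastLessThan:
  assumes "0 \<le> c" "c \<le> d" "d \<le> mass"
  shows "measure \<sigma> {t. c \<le> cdf \<sigma> t \<and> cdf \<sigma> t < d} = d - c"
proof -
  have "{t. c \<le> cdf \<sigma> t \<and> cdf \<sigma> t < d} = {t. cdf \<sigma> t < d} - {t. cdf \<sigma> t < c}"
    by auto
  also have "measure \<sigma> \<dots> = measure \<sigma> {t. cdf \<sigma> t < d} - measure \<sigma> {t. cdf \<sigma> t < c}"
    using assms by (intro finite_measure_Diff) auto
  finally show ?thesis
    using assms by (simp add: measure_cdf_less)
qed

text \<open>For \<open>c\<close> below \<open>mass\<close>, a level set lies in the band from
  \<open>c\<close> to \<open>c + e\<close>, whose mass is at most \<open>e\<close>. The level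
  \<open>mass\<close> is the complement of a set of full measure.\<close>

lemma AE_cdf_neq: "AE t in \<sigma>. cdf \<sigma> t \<noteq> c"
proof -
  have "measure \<sigma> {t. cdf \<sigma> t = c} = 0"
  proof (cases "0 \<le> c \<and> c < mass")
    case True
    have "measure \<sigma> {t. cdf \<sigma> t = c} \<le> 0 + e" if e: "0 < e" for e
    proof -
      define d where "d = min mass (c + e)"
      have "measure \<sigma> {t. cdf \<sigma> t = c} \<le> measure \<sigma> {t. c \<le> cdf \<sigma> t \<and> cdf \<sigma> t < d}"
        using True e by (intro finite_measure_mono) (auto simp: d_def)
      also have "\<dots> = d - c"
        using True e by (intro measure_cdf_atLeastLessThan) (auto simp: d_def)
      finally show ?thesis by (simp add: d_def)
    qed
    then have "measure \<sigma> {t. cdf \<sigma> t = c} \<le> 0" by (rule field_le_epsilon)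
    then show ?thesis by (simp add: measure_le_0_iff)
  next
    case False
    show ?thesis
    proof (cases "c = mass")
      case True
      have "{t. cdf \<sigma> t = c} = UNIV - {t. cdf \<sigma> t < mass}"
        using cdf_le_mass by (auto simp: True not_less intro: antisym)
      also have "measure \<sigma> \<dots> = mass - measure \<sigma> {t. cdf \<sigma> t < mass}"
        by (intro finite_measure_Diff) auto
      finally show ?thesis by (simp add: measure_cdf_less)
    next
      case c: False
      have "cdf \<sigma> t \<noteq> c" for t
        using False c cdf_nonneg[of t] cdf_le_mass[of t] by auto
      then have "{t. cdf \<sigma> t = c} = {}" by simp
      then show ?thesis by simp
    qed
  qed
  then have "{t. cdf \<sigma> t = c} \<in> null_sets \<sigma>"
    by (auto simp: null_sets_def emeasure_eq_measure)
  then show ?thesis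
    by (rule AE_I') auto
qed

section \<open>Cut points as levels of the distribution function\<close>

text \<open>Inductively, the mass between cut \<open>i\<close> and \<open>t\<close> is
  \<open>cdf \<sigma> t\<close> minus \<open>i\<close> shares \<open>mass / N\<close>, so asking for
  one more share is asking for level \<open>(i + 1) * mass / N\<close>. The maximum with 0 covers
  the empty interval when \<open>t\<close> lies left of the cut.\<close>

lemma cut_positive:
  assumes "0 < mass" "0 < i" "i < N"
  shows "cut \<sigma> N i = ereal (quantile \<sigma> (real i * mass / real N))"
    and "measure \<sigma> (einterval (cut \<sigma> N i) (ereal t)) = max 0 (cdf \<sigma> t - real i * mass / real N)"
proof -
  have level: "0 < real i * mass / real N" "real i * mass / real N < mass" if "0 < i" "i < N" for i
    using assms(1) that by (auto simp: field_simps)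
  have meas: "measure \<sigma> (einterval (ereal (quantile \<sigma> s)) (ereal t)) = max 0 (cdf \<sigma> t - s)"
    if s: "0 < s" "s < mass" for s t
  proof -
    have "einterval (ereal (quantile \<sigma> s)) (ereal t) = {quantile \<sigma> s<..<t}"
      by (auto simp: einterval_def)
    moreover have "measure \<sigma> {quantile \<sigma> s<..<t} = max 0 (cdf \<sigma> t - s)"
    proof (cases "quantile \<sigma> s \<le> t")
      case True
      then show ?thesis
        using measure_Ioo[OF True] quantile_least(2)[OF s] quantile_le_iff[OF s, of t] by simp
    next
      case False
      then show ?thesis
        using quantile_le_iff[OF s, of t] by simp
    qed
    ultimately show ?thesis by simp
  qed
  have cut: "cut \<sigma> N i = ereal (quantile \<sigma> (real i * mass / real N))" if "0 < i" "i < N" for i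
    using that
  proof (induction i)
    case (Suc i)
    let ?s = "real (Suc i) * mass / real N"
    note s = level[OF Suc.prems]
    have "mass / real N \<le> measure \<sigma> (einterval (cut \<sigma> N i) (ereal t)) \<longleftrightarrow> ?s \<le> cdf \<sigma> t" for t
    proof (cases "i = 0")
      case True
      have "einterval (-\<infinity>) (ereal t) = {..<t}" by (auto simp: einterval_def)
      with True show ?thesis by (simp add: measure_lessThan)
    next
      case False
      have "0 < mass / real N" using assms by simp
      with False Suc show ?thesis
        by (subst Suc.IH; (subst meas)?) (auto simp: level add_divide_distrib distrib_right le_max_iff_disj)
    qed
    then have "cut \<sigma> N (Suc i) = Inf (ereal ` {t. ?s \<le> cdf \<sigma> t})"
      using Suc.prems by simp
    also have "\<dots> = ereal (quantile \<sigma> ?s)"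
      unfolding quantile_least(1)[OF s] by (intro Inf_eqI) auto
    finally show ?case .
  qed simp
  show "cut \<sigma> N i = ereal (quantile \<sigma> (real i * mass / real N))"
    using cut assms by simp
  show "measure \<sigma> (einterval (cut \<sigma> N i) (ereal t)) = max 0 (cdf \<sigma> t - real i * mass / real N)"
    unfolding cut[OF assms(2,3)] using meas level assms by simp
qed


lemma measure_einterval_cut:
  assumes "0 < mass" "i < N"
  shows "measure \<sigma> (einterval (cut \<sigma> N i) (ereal t)) = max 0 (cdf \<sigma> t - real i * (mass / real N))"
proof (cases "i = 0")
  case True
  have "einterval (-\<infinity>) (ereal t) = {..<t}" by (auto simp: einterval_def)
  with True show ?thesis by (simp add: measure_lessThan cdf_nonneg)
next
  case False
  with assms show ?thesis by (simp add: cut_positive(2))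
qed

text \<open>This lemma and the next two pass between end points of pieces and levels of the
  distribution function. Strict bounds on levels suffice later, since every single level is
  null.\<close>

lemma cdf_ge_if_cut_le:
  assumes "0 < mass" "i \<le> N" "cut \<sigma> N i \<le> ereal t"
  shows "real i * (mass / real N) \<le> cdf \<sigma> t"
proof -
  have "i < N \<or> i = N"
    using assms by auto
  moreover have "i < N \<Longrightarrow> 0 < i \<Longrightarrow> real i * mass / real N < mass"
    using assms(1) by (simp add: field_simps)
  moreover have "cut \<sigma> N N = \<infinity>" if "0 < N"
    using that by (cases N) auto
  ultimately show ?thesis
    using assms cut_positive(1)[of i N] quantile_le_iff[of "real i * mass / real N" t]
    by (cases "i = 0") (auto simp: cdf_nonneg)
qed

lemma cut_le_if_cdf_gt:
  assumes "0 < mass" "i < N" "real i * (mass / real N) < cdf \<sigma> t"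
  shows "cut \<sigma> N i \<le> ereal t"
proof -
  have "i < N \<Longrightarrow> 0 < i \<Longrightarrow> real i * mass / real N < mass"
    using assms(1) by (simp add: field_simps)
  then show ?thesis
    using assms cut_positive(1)[of i N] quantile_le_iff[of "real i * mass / real N" t]
    by (cases "i = 0") auto
qed

lemma le_cut_if_cdf_less:
  assumes "0 < mass" "0 < i" "i \<le> N" "cdf \<sigma> t < real i * (mass / real N)"
  shows "ereal t \<le> cut \<sigma> N i"
proof (cases "i = N")
  case True
  then show ?thesis using assms(2) by (cases i) auto
next
  case False
  then have "real i * mass / real N < mass"
    using assms by (simp add: field_simps)
  then show ?thesis
    using False assms cut_positive(1)[of i N] quantile_le_iff[of "real i * mass / real N" t]
    by auto
qed

section \<open>Cyclic permutation of pieces as a rotation of levels\<close>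

text \<open>Going from piece \<open>j\<close> to piece \<open>k\<close> translates levels by
  \<open>k - j\<close> shares. Either \<open>k = m + j - 1\<close> and there is no wrap-around, or
  \<open>k = m + j - 1 - N\<close> and \<open>rotate\<close> subtracts \<open>mass\<close>; the
  bounds on \<open>s\<close> place it on the right side of the wrap-around point.\<close>

lemma rotate_level:
  assumes "0 < mass" "m \<in> {1..N}" "j \<in> {1..N}" "k \<in> {1..N}" "k mod N = (m + j - 1) mod N"
    and s: "real (j - 1) * (mass / real N) < s" "s < real j * (mass / real N)"
  shows "rotate mass (real (m - 1) * (mass / real N)) s
    = s + real (k - 1) * (mass / real N) - real (j - 1) * (mass / real N)"
proof -
  define a where "a = mass / real N"
  have N: "0 < N" and mass: "mass = real N * a"
    using assms by (auto simp: a_def)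
  then have a: "0 < a" using assms(1) by (simp add: a_def)
  show ?thesis
  proof (cases "m + j - 1 \<le> N")
    case True
    have "k = m + j - 1"
    proof (cases "m + j - 1 = N")
      case eq: True
      then have "N dvd k" using assms(5) by auto
      then show ?thesis using assms(4) eq by (auto dest: dvd_imp_le)
    next
      case False
      then have "k mod N = m + j - 1" using True assms(5) by simp
      then show ?thesis using assms(2-4) by (cases "k = N") auto
    qed
    then have k: "real (k - 1) = real (m - 1) + real (j - 1)"
      using assms(2-4) by auto
    have "real j + real (m - 1) \<le> real N"
      using True assms(2,3) by auto
    then have "(real j + real (m - 1)) * a \<le> real N * a"
      using a by (intro mult_right_mono) auto
    then have "s + real (m - 1) * a < mass"
      using s unfolding a_def[symmetric] unfolding mass distrib_right by linarith
    then show ?thesis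
      unfolding rotate_def a_def[symmetric] k by (simp add: distrib_right)
  next
    case False
    then have "m + j - 1 - N < N" "(m + j - 1) mod N = m + j - 1 - N"
      using assms(2,3) by (auto simp: le_mod_geq)
    then have "k = m + j - 1 - N"
      using False assms(2-5) by (cases "k = N") auto
    then have "k - 1 + N = (m - 1) + (j - 1)"
      using False assms(2-4) by auto
    then have k: "real (k - 1) + real N = real (m - 1) + real (j - 1)"
      by (simp only: of_nat_add[symmetric])
    have "real N \<le> real (j - 1) + real (m - 1)"
      using False assms(2,3) by auto
    then have "real N * a \<le> (real (j - 1) + real (m - 1)) * a"
      using a by (intro mult_right_mono) auto
    then have "\<not> s + real (m - 1) * a < mass"
      using s unfolding a_def[symmetric] unfolding mass distrib_right by linarith
    moreover have "real (k - 1) * a + real N * a = real (m - 1) * a + real (j - 1) * a"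
      unfolding distrib_right[symmetric] k ..
    ultimately show ?thesis
      unfolding rotate_def a_def[symmetric] using mass by simp
  qed
qed

text \<open>The least \<open>j\<close> whose upper level exceeds \<open>cdf \<sigma> t\<close>
  works; avoiding the boundary levels makes the lower bound strict.\<close>

lemma level_exists:
  assumes "0 < mass" "0 < N" "\<forall>i\<le>N. cdf \<sigma> t \<noteq> real i * (mass / real N)"
  shows "\<exists>j\<in>{1..N}. real (j - 1) * (mass / real N) < cdf \<sigma> t \<and> cdf \<sigma> t < real j * (mass / real N)"
proof -
  let ?P = "\<lambda>j. cdf \<sigma> t < real j * (mass / real N)"
  define j where "j = (LEAST j. ?P j)"
  have PN: "?P N"
    using assms cdf_le_mass[of t] assms(3)[rule_format, of N] by simp
  then have P: "?P j" and jN: "j \<le> N"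
    unfolding j_def by (rule LeastI, rule Least_le)
  have "\<not> ?P 0" using cdf_nonneg[of t] by simp
  with P have j: "1 \<le> j" by (cases j) auto
  then have "\<not> ?P (j - 1)"
    using not_less_Least[of "j - 1" ?P] unfolding j_def[symmetric] by linarith
  moreover have "cdf \<sigma> t \<noteq> real (j - 1) * (mass / real N)"
    using assms(3) jN by simp
  ultimately show ?thesis using P j jN by (intro bexI[of _ j]) auto
qed

text \<open>In the coordinate \<open>cdf \<sigma>\<close> the cyclic permutation of the pieces is a rotation of the
  circle of length \<open>mass\<close>.\<close>

lemma cyclic_map_iff_rotate:
  assumes mass: "0 < mass" and m: "m \<in> {1..N}"
  shows "cyclic_map \<sigma> N m F \<longleftrightarrow>
    (AE t in \<sigma>. cdf \<sigma> (F t) = rotate mass (real (m - 1) * (mass / real N)) (cdf \<sigma> t))"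
    (is "_ \<longleftrightarrow> (AE t in \<sigma>. ?R t)")
proof
  have N: "0 < N" using m by auto
  \<comment> \<open>Only the \<open>N + 1\<close> boundary levels have to be avoided, and each is a
    null level set.\<close>
  have generic: "AE t in \<sigma>. \<forall>i\<le>N. cdf \<sigma> t \<noteq> real i * (mass / real N)"
    by (subst AE_all_countable) (auto intro: AE_mp[OF AE_cdf_neq])
  {
    assume "cyclic_map \<sigma> N m F"
    then have "AE t in \<sigma>. \<forall>j\<in>{1..N}. \<forall>k\<in>{1..N}. k mod N = (m + j - 1) mod N \<longrightarrow>
        (t \<in> piece \<sigma> N j \<longrightarrow> F t \<in> piece \<sigma> N k \<and>
         measure \<sigma> (einterval (cut \<sigma> N (k - 1)) (ereal (F t))) =
         measure \<sigma> (einterval (cut \<sigma> N (j - 1)) (ereal t)))"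
      unfolding cyclic_map_def by (auto intro!: AE_finite_allI)
    with generic show "AE t in \<sigma>. ?R t"
    proof eventually_elim
      case (elim t)
      obtain j where j: "j \<in> {1..N}" "real (j - 1) * (mass / real N) < cdf \<sigma> t"
          "cdf \<sigma> t < real j * (mass / real N)"
        using level_exists[OF mass N elim(1)] by auto
      obtain k where k: "k \<in> {1..N}" "k mod N = (m + j - 1) mod N"
        using ex_mod_eq_atLeastAtMost[OF N] by blast
      have "t \<in> piece \<sigma> N j"
        using j cut_le_if_cdf_gt[OF mass, of "j - 1" N t] le_cut_if_cdf_less[OF mass, of j N t]
        by (auto simp: piece_def)
      with elim(2) j(1) k have F: "F t \<in> piece \<sigma> N k"
        "measure \<sigma> (einterval (cut \<sigma> N (k - 1)) (ereal (F t))) =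
         measure \<sigma> (einterval (cut \<sigma> N (j - 1)) (ereal t))"
        by blast+
      have "real (k - 1) * (mass / real N) \<le> cdf \<sigma> (F t)"
        using F(1) k(1) by (intro cdf_ge_if_cut_le[OF mass]) (auto simp: piece_def)
      moreover have "max 0 (cdf \<sigma> (F t) - real (k - 1) * (mass / real N))
          = max 0 (cdf \<sigma> t - real (j - 1) * (mass / real N))"
        using F(2) j(1) k(1) measure_einterval_cut[OF mass, of "k - 1" N "F t"]
          measure_einterval_cut[OF mass, of "j - 1" N t] by auto
      ultimately show ?case
        using j(2) rotate_level[OF mass m j(1) k j(2,3)] by linarith
    qed
  next
    assume R: "AE t in \<sigma>. ?R t"
    show "cyclic_map \<sigma> N m F"
      unfolding cyclic_map_def
    proof (intro ballI impI)
      fix j k assume jk: "j \<in> {1..N}" "k \<in> {1..N}" "k mod N = (m + j - 1) mod N"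
      have j1: "real j * (mass / real N) = real (j - 1) * (mass / real N) + mass / real N"
       and k1: "real k * (mass / real N) = real (k - 1) * (mass / real N) + mass / real N"
        using jk by (auto simp: of_nat_diff diff_divide_distrib left_diff_distrib)
      show "AE t in \<sigma>. t \<in> piece \<sigma> N j \<longrightarrow>
           F t \<in> piece \<sigma> N k \<and>
           measure \<sigma> (einterval (cut \<sigma> N (k - 1)) (ereal (F t))) =
           measure \<sigma> (einterval (cut \<sigma> N (j - 1)) (ereal t))"
        using R generic
      proof eventually_elim
        case (elim t)
        show ?case
        proof
          assume t: "t \<in> piece \<sigma> N j"
          have lo: "real (j - 1) * (mass / real N) < cdf \<sigma> t"
            using t jk elim(2)[rule_format, of "j - 1"] cdf_ge_if_cut_le[OF mass, of "j - 1" N t]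
            by (force simp: piece_def)
          \<comment> \<open>A point of piece \<open>j\<close> lies at or left of the cut
            \<open>j\<close>, whose level is exactly \<open>j\<close> shares; for
            \<open>j = N\<close> the bound is \<open>mass\<close> itself.\<close>
          have hi: "cdf \<sigma> t < real j * (mass / real N)"
          proof (rule ccontr)
            assume "\<not> ?thesis"
            then have gt: "real j * (mass / real N) < cdf \<sigma> t"
              using elim(2)[rule_format, of j] jk by auto
            have jN: "j < N"
              using gt cdf_le_mass[of t] N jk by (cases "j = N") auto
            have "cut \<sigma> N j = ereal (quantile \<sigma> (real j * mass / real N))"
              using jk jN by (intro cut_positive(1)[OF mass]) auto
            then have "t \<le> quantile \<sigma> (real j * mass / real N)"
              using t by (simp add: piece_def)
            moreover have "cdf \<sigma> (quantile \<sigma> (real j * mass / real N)) = real j * mass / real N"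
              using jk jN mass by (intro quantile_least(2)) (auto simp: field_simps)
            ultimately show False
              using cdf_nondecreasing[of t] gt by fastforce
          qed
          note eq = elim(1)[unfolded rotate_level[OF mass m jk lo hi]]
          have Flo: "real (k - 1) * (mass / real N) < cdf \<sigma> (F t)"
            and Fhi: "cdf \<sigma> (F t) < real k * (mass / real N)"
            using eq lo hi j1 k1 by linarith+
          have "F t \<in> piece \<sigma> N k"
            using Flo Fhi jk(2) cut_le_if_cdf_gt[OF mass, of "k - 1" N "F t"]
              le_cut_if_cdf_less[OF mass, of k N "F t"]
            by (auto simp: piece_def)
          moreover have k': "k - 1 < N" and j': "j - 1 < N"
            using jk by auto
          have "measure \<sigma> (einterval (cut \<sigma> N (k - 1)) (ereal (F t))) =
              measure \<sigma> (einterval (cut \<sigma> N (j - 1)) (ereal t))"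
            using measure_einterval_cut[OF mass k', of "F t"] measure_einterval_cut[OF mass j', of t] eq
            by simp
          ultimately show "F t \<in> piece \<sigma> N k \<and>
              measure \<sigma> (einterval (cut \<sigma> N (k - 1)) (ereal (F t))) =
              measure \<sigma> (einterval (cut \<sigma> N (j - 1)) (ereal t))" ..
        qed
      qed
    qed
  }
qed

section \<open>Invariance and existence on one line\<close>

text \<open>The levels sent below \<open>c\<close> are those below \<open>c - b\<close>, if any, and
  an interval starting at the wrap-around point \<open>mass - b\<close>; the two lengths add up to
  \<open>c\<close>. The level \<open>mass\<close> lies in neither set and is discarded as
  null.\<close>

lemma measure_rotate_less:
  assumes "0 \<le> b" "b \<le> mass" "0 \<le> c" "c \<le> mass"
  shows "measure \<sigma> {t. rotate mass b (cdf \<sigma> t) < c} = c"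
proof -
  let ?A = "{t. cdf \<sigma> t < max 0 (c - b)}"
  let ?B = "{t. mass - b \<le> cdf \<sigma> t \<and> cdf \<sigma> t < min mass (c + mass - b)}"
  have "AE t in \<sigma>. (t \<in> {t. rotate mass b (cdf \<sigma> t) < c}) = (t \<in> ?A \<union> ?B)"
    using AE_cdf_neq[of mass]
  proof eventually_elim
    case (elim t)
    then show ?case
      using cdf_nonneg[of t] cdf_le_mass[of t] assms by (auto simp: rotate_def)
  qed
  then have "measure \<sigma> {t. rotate mass b (cdf \<sigma> t) < c} = measure \<sigma> (?A \<union> ?B)"
    by (intro finite_measure_eq_AE) auto
  also have "\<dots> = measure \<sigma> ?A + measure \<sigma> ?B"
    using assms by (intro finite_measure_Union) auto
  also have "\<dots> = max 0 (c - b) + (min mass (c + mass - b) - (mass - b))"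
    using assms measure_cdf_less[of "max 0 (c - b)"]
      measure_cdf_atLeastLessThan[of "mass - b" "min mass (c + mass - b)"] by simp
  also have "\<dots> = c" using assms by auto
  finally show ?thesis .
qed

lemma distr_rotate:
  assumes [measurable]: "F \<in> borel_measurable borel"
    and b: "0 \<le> b" "b \<le> mass"
    and F: "AE t in \<sigma>. cdf \<sigma> (F t) = rotate mass b (cdf \<sigma> t)"
  shows "distr \<sigma> borel F = \<sigma>"
proof (rule cdf_unique')
  show "finite_borel_measure (distr \<sigma> borel F)"
    by (auto simp: finite_borel_measure_def finite_borel_measure_axioms_def intro!: finite_measure_distr)
  show "finite_borel_measure \<sigma>" ..
  show "cdf (distr \<sigma> borel F) = cdf \<sigma>"
  proof
    fix x
    \<comment> \<open>These are the two levels that the branches of the rotation could send to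
      \<open>cdf \<sigma> x\<close>. Off them, \<open>F t \<le> x\<close> amounts to a strict
      inequality between levels.\<close>
    have neq: "AE t in \<sigma>. rotate mass b (cdf \<sigma> t) \<noteq> cdf \<sigma> x"
      using AE_cdf_neq[of "cdf \<sigma> x - b"] AE_cdf_neq[of "cdf \<sigma> x - b + mass"]
      by eventually_elim (auto simp: rotate_def)
    have "cdf (distr \<sigma> borel F) x = measure \<sigma> {t. F t \<le> x}"
      unfolding cdf_def by (subst measure_distr) (auto intro!: arg_cong[where f="measure \<sigma>"])
    also have "\<dots> = measure \<sigma> {t. rotate mass b (cdf \<sigma> t) < cdf \<sigma> x}"
    proof (rule finite_measure_eq_AE)
      show "AE t in \<sigma>. (t \<in> {t. F t \<le> x}) = (t \<in> {t. rotate mass b (cdf \<sigma> t) < cdf \<sigma> x})"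
        using F neq
      proof eventually_elim
        case (elim t)
        then show ?case
          using cdf_nondecreasing[of "F t" x] cdf_nondecreasing[of x "F t"] by force
      qed
    qed auto
    also have "\<dots> = cdf \<sigma> x"
      using b cdf_nonneg cdf_le_mass by (intro measure_rotate_less)
    finally show "cdf (distr \<sigma> borel F) x = cdf \<sigma> x" .
  qed
qed

lemma distr_cyclic_map:
  assumes "F \<in> borel_measurable borel" "0 < mass" "m \<in> {1..N}" "cyclic_map \<sigma> N m F"
  shows "distr \<sigma> borel F = \<sigma>"
proof (rule distr_rotate)
  have "real (m - 1) * (mass / real N) \<le> real N * (mass / real N)"
    using assms by (intro mult_right_mono) auto
  then show "real (m - 1) * (mass / real N) \<le> mass" "0 \<le> real (m - 1) * (mass / real N)"
    using assms by auto
qed (use assms cyclic_map_iff_rotate in auto)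

text \<open>\<open>F\<close> is prescribed only where the rotated level lies strictly inside (0,
  mass), where the quantile is a true right inverse of the distribution function. Elsewhere any
  default value is allowed.\<close>

lemma cyclic_map_quantile:
  assumes mass: "0 < mass" and m: "m \<in> {1..N}"
    and F: "\<And>t. 0 < rotate mass (real (m - 1) * (mass / real N)) (cdf \<sigma> t) \<Longrightarrow>
      rotate mass (real (m - 1) * (mass / real N)) (cdf \<sigma> t) < mass \<Longrightarrow>
      F t = quantile \<sigma> (rotate mass (real (m - 1) * (mass / real N)) (cdf \<sigma> t))"
  shows "cyclic_map \<sigma> N m F"
  unfolding cyclic_map_iff_rotate[OF mass m]
proof -
  define b where "b = real (m - 1) * (mass / real N)"
  have "real (m - 1) * (mass / real N) < real N * (mass / real N)"
    using assms by (intro mult_strict_right_mono) auto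
  then have b: "0 \<le> b" "b < mass"
    using assms by (auto simp: b_def)
  have "AE t in \<sigma>. cdf \<sigma> (F t) = rotate mass b (cdf \<sigma> t)"
    \<comment> \<open>The rotation sends \<open>mass - b\<close> to 0, and 0 and \<open>mass\<close>
      are the end levels; off these three the rotated level lies strictly inside.\<close>
    using AE_cdf_neq[of 0] AE_cdf_neq[of mass] AE_cdf_neq[of "mass - b"]
  proof eventually_elim
    case (elim t)
    then have "0 < rotate mass b (cdf \<sigma> t)" "rotate mass b (cdf \<sigma> t) < mass"
      using b cdf_nonneg[of t] cdf_le_mass[of t] by (auto simp: rotate_def)
    then show ?case
      using F[folded b_def] quantile_least(2) by simp
  qed
  then show "AE t in \<sigma>. cdf \<sigma> (F t) = rotate mass (real (m - 1) * (mass / real N)) (cdf \<sigma> t)"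
    by (simp only: b_def)
qed

end

lemma atomless_real_measure_density:
  assumes [measurable]: "f \<in> borel_measurable borel"
    and fin: "(\<integral>\<^sup>+ r. f r \<partial>lborel) \<noteq> \<infinity>"
  shows "atomless_real_measure (density lborel f)"
proof -
  have "finite_measure (density lborel f)"
    using fin by (intro finite_measureI) (simp add: emeasure_density)
  moreover have "measure (density lborel f) {x} = 0" for x
  proof -
    have "emeasure (density lborel f) {x} = 0"
      using AE_lborel_singleton[of x]
      by (subst emeasure_density) (auto simp: nn_integral_0_iff_AE elim!: eventually_mono)
    then show ?thesis by (simp add: measure_def)
  qed
  ultimately show ?thesis
    by (simp add: atomless_real_measure_def atomless_real_measure_axioms_def
        finite_borel_measure_def finite_borel_measure_axioms_def)
qed

lemma measure_density_UNIV:
  assumes [measurable]: "f \<in> borel_measurable borel"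
  shows "measure (density lborel f) UNIV = enn2real (\<integral>\<^sup>+ r. f r \<partial>lborel)"
  by (simp add: measure_def emeasure_density)

section \<open>Polar-like coordinates\<close>

lemma span_eq_line:
  assumes "L \<in> lines" "v \<in> L" "v \<noteq> 0"
  shows "span {v} = L"
proof (rule subspace_dim_equal)
  show "span {v} \<subseteq> L"
    using assms by (intro span_minimal) (auto simp: lines_def)
  show "dim L \<le> dim (span {v})"
    using assms dim_eq_card_independent[of "{v}"] by (auto simp: lines_def)
qed (use assms in \<open>auto simp: lines_def\<close>)

lemma span_in_lines:
  fixes v :: "'a::euclidean_space"
  assumes "v \<noteq> 0"
  shows "span {v} \<in> lines"
  using assms dim_eq_card_independent[of "{v}"] by (auto simp: lines_def)

lemma space_uniform_lines [simp]: "space uniform_lines = lines"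
  using sets_eq_imp_space_eq[OF sets_uniform_lines] by simp

lemma lines_nonempty: "lines \<noteq> ({} :: 'a::euclidean_space set set)"
  using span_in_lines[of "SOME b. b \<in> (Basis :: 'a set)"] SOME_Basis[where 'a='a] nonzero_Basis by fastforce

text \<open>Unfolding the uniform measure as the law of the line through a random point of the
  punctured ball turns null sets of lines into Lebesgue null sets of points.\<close>

lemma AE_uniform_lines_iff:
  fixes P :: "'a::euclidean_space set \<Rightarrow> bool"
  assumes "{\<theta> \<in> lines. P \<theta>} \<in> sets line_algebra"
  shows "(AE \<theta> in uniform_lines. P \<theta>) \<longleftrightarrow>
    (AE x in lborel. x \<in> ball 0 1 \<longrightarrow> x \<noteq> 0 \<longrightarrow> P (span {x}))"
proof -
  have m: "(\<lambda>x. span {x}) \<in> restrict_space (uniform_measure lborel (ball (0::'a) 1)) (- {0}) \<rightarrow>\<^sub>M line_algebra"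
    by (subst measurable_cong_sets[OF sets_restrict_space_cong refl, of _ borel])
      (simp_all add: span_measurable)
  have fin: "emeasure lborel (ball (0::'a) 1) < \<infinity>"
    using emeasure_lborel_ball_finite[of "0::'a" 1] by simp
  have pos: "emeasure lborel (ball (0::'a) 1) \<noteq> 0"
    using content_ball_pos[of 1 "0::'a"] by (auto simp: measure_def)
  show ?thesis
    unfolding uniform_lines_def
    by (subst AE_distr_iff[OF m]) (use assms fin pos in \<open>simp_all add: AE_restrict_space_iff AE_uniform_measure\<close>)
qed

lemma AE_lborel_scaleR:
  fixes P :: "'a::euclidean_space \<Rightarrow> bool"
  assumes "c \<noteq> 0" and [measurable]: "Measurable.pred borel P" and "AE x in lborel. P (c *\<^sub>R x)"
  shows "AE x in lborel. P x"
  using assms(1,3) by (subst lborel_affine[of c 0]) (auto simp: AE_density AE_distr_iff)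

section \<open>Signed coordinates for a chosen direction on each line\<close>

locale line_directions =
  fixes u :: "'a::euclidean_space set \<Rightarrow> 'a"
  assumes direction: "direction_choice u"
begin

lemma direction_measurable [measurable]: "u \<in> line_algebra \<rightarrow>\<^sub>M borel"
  using direction by (simp add: direction_choice_def)

lemma direction_mem: "\<theta> \<in> lines \<Longrightarrow> u \<theta> \<in> \<theta>"
  and norm_direction: "\<theta> \<in> lines \<Longrightarrow> norm (u \<theta>) = 1"
  using direction by (auto simp: direction_choice_def)

text \<open>Giving the origin radius 0 on some line makes \<open>polar (coords x) = x\<close> hold
  everywhere; the other composition is claimed only for nonzero radius.\<close>

definition coords :: "'a \<Rightarrow> real \<times> 'a set" where
  "coords x = (if x = 0 then (0, SOME L. L \<in> lines) else (x \<bullet> u (span {x}), span {x}))"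

abbreviation polar :: "real \<times> 'a set \<Rightarrow> 'a" where
  "polar \<equiv> (\<lambda>(r, \<theta>). r *\<^sub>R u \<theta>)"

abbreviation polar_measure :: "(real \<times> 'a set) measure" where
  "polar_measure \<equiv> lborel \<Otimes>\<^sub>M uniform_lines"

lemma sets_polar_measure: "sets polar_measure = sets (borel \<Otimes>\<^sub>M line_algebra)"
  by (intro sets_pair_measure_cong) auto

lemma scaleR_inner_direction:
  assumes "\<theta> \<in> lines" "x \<in> \<theta>"
  shows "(x \<bullet> u \<theta>) *\<^sub>R u \<theta> = x"
proof -
  have "u \<theta> \<noteq> 0" using norm_direction[OF assms(1)] by auto
  then have "x \<in> span {u \<theta>}"
    using span_eq_line[OF assms(1) direction_mem[OF assms(1)]] assms(2) by simp
  then obtain c where c: "x = c *\<^sub>R u \<theta>"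
    by (auto simp: span_singleton)
  have "u \<theta> \<bullet> u \<theta> = 1"
    using norm_direction[OF assms(1)] by (simp add: norm_eq_1)
  with c show ?thesis by simp
qed

lemma polar_coords: "polar (coords x) = x"
  using scaleR_inner_direction[OF span_in_lines, of x x]
  by (auto simp: coords_def span_base)

lemma coords_polar:
  assumes "\<theta> \<in> lines" "r \<noteq> 0"
  shows "coords (r *\<^sub>R u \<theta>) = (r, \<theta>)"
proof -
  have u: "u \<theta> \<noteq> 0" using norm_direction[OF assms(1)] by auto
  have "r *\<^sub>R u \<theta> \<in> \<theta>"
    using assms(1) direction_mem[OF assms(1)] by (auto simp: lines_def intro: subspace_scale)
  then have "span {r *\<^sub>R u \<theta>} = \<theta>"
    using assms u by (intro span_eq_line) auto
  moreover have "u \<theta> \<bullet> u \<theta> = 1"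
    using norm_direction[OF assms(1)] by (simp add: norm_eq_1)
  ultimately show ?thesis
    using assms u by (simp add: coords_def)
qed

lemma coords_measurable [measurable]: "coords \<in> borel \<rightarrow>\<^sub>M borel \<Otimes>\<^sub>M line_algebra"
proof -
  have *: "{x::'a. x \<noteq> 0} = - {0}" by auto
  have [measurable]: "(\<lambda>x::'a. u (span {x})) \<in> restrict_space borel (- {0}) \<rightarrow>\<^sub>M borel"
    by (rule measurable_compose[OF span_measurable direction_measurable])
  have [measurable]: "(\<lambda>x::'a. x) \<in> restrict_space borel (- {0}) \<rightarrow>\<^sub>M borel"
    by (intro measurable_restrict_space1) simp
  have "(SOME L. L \<in> lines) \<in> (lines :: 'a set set)"
    using lines_nonempty by (auto intro: someI)
  then show ?thesis
    unfolding coords_def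
    by (subst measurable_If_restrict_space_iff) (auto simp: * intro!: measurable_Pair borel_measurable_inner span_measurable)
qed

lemma coords_measurable_polar [measurable]: "coords \<in> borel \<rightarrow>\<^sub>M polar_measure"
  by (subst measurable_cong_sets[OF refl sets_polar_measure]) (rule coords_measurable)

lemma polar_measurable [measurable]: "polar \<in> polar_measure \<rightarrow>\<^sub>M borel"
  by (subst measurable_cong_sets[OF sets_polar_measure refl]) measurable

text \<open>For \<open>x\<close> in the unit ball the ray through \<open>x\<close> almost surely meets the null set in a null set
  of parameters \<open>s\<close>; exchanging \<open>x\<close> and \<open>s\<close>, almost every dilation of the ball avoids it almost
  everywhere. This replaces the integration formula in polar coordinates.\<close>

lemma AE_coords_notin_null_set:
  assumes S: "S \<in> null_sets polar_measure"
  shows "AE x in lborel. coords x \<notin> S"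
proof -
  interpret U: prob_space "uniform_lines :: 'a set measure" by (rule prob_space_uniform_lines)
  interpret P: pair_sigma_finite "lborel :: real measure" "uniform_lines :: 'a set measure" ..
  have [measurable]: "S \<in> sets polar_measure" "S \<in> sets (borel \<Otimes>\<^sub>M line_algebra)"
    using S sets_polar_measure by auto
  define E where "E = {x. coords x \<in> S}"
  have E[measurable]: "E \<in> sets borel"
    unfolding E_def by measurable
  have null_fibre_iff: "(AE r in lborel. (r, \<theta>) \<notin> S) \<longleftrightarrow> emeasure lborel ((\<lambda>r. (r, \<theta>)) -` S) = 0"
    if "\<theta> \<in> lines" for \<theta>
  proof -
    have "(\<lambda>r. (r, \<theta>)) -` S \<in> sets lborel"
      by (rule sets_Pair2) measurable
    then show ?thesis
      by (subst AE_iff_null) (auto simp: null_sets_def vimage_def)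
  qed
  \<comment> \<open>Measurability of the set of lines with null fibre is what permits the passage
    from lines to points of the ball.\<close>
  have "(\<lambda>\<theta>. emeasure lborel ((\<lambda>r. (r, \<theta>)) -` S)) \<in> borel_measurable line_algebra"
    using P.measurable_emeasure_Pair2[of S] by (simp add: measurable_cong_sets[OF sets_uniform_lines refl])
  then have "{\<theta> \<in> space line_algebra. emeasure lborel ((\<lambda>r. (r, \<theta>)) -` S) = 0} \<in> sets line_algebra"
    by measurable
  then have null_fibres: "{\<theta> \<in> lines. AE r in lborel. (r, \<theta>) \<notin> S} \<in> sets line_algebra"
    using null_fibre_iff by (simp cong: conj_cong)
  have dilation: "{z \<in> space (lborel \<Otimes>\<^sub>M lborel). fst z \<in> ball 0 1 \<longrightarrow> snd z *\<^sub>R fst z \<notin> E}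
      \<in> sets ((lborel :: 'a measure) \<Otimes>\<^sub>M (lborel :: real measure))" (is "?D \<in> sets ?L")
  proof -
    have "(\<lambda>z. snd z *\<^sub>R fst z) \<in> ?L \<rightarrow>\<^sub>M borel" by measurable
    then have "(\<lambda>z. snd z *\<^sub>R fst z) -` E \<inter> space ?L \<in> sets ?L"
      using E by (rule measurable_sets)
    moreover have "{z \<in> space ?L. norm (fst z) < 1} \<in> sets ?L" by measurable
    moreover have "?D = space ?L - ((\<lambda>z. snd z *\<^sub>R fst z) -` E \<inter> space ?L) \<inter> {z \<in> space ?L. norm (fst z) < 1}"
      by auto
    ultimately show ?thesis by (simp only: sets.Diff sets.Int sets.top)
  qed
  have "AE r in lborel. AE \<theta> in uniform_lines. (r, \<theta>) \<notin> S"
    by (rule P.AE_pair[OF AE_not_in[OF S]])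
  then have "AE \<theta> in uniform_lines. AE r in lborel. (r, \<theta>) \<notin> S"
    by (subst (asm) P.AE_commute) measurable
  then have "AE x in lborel. x \<in> ball 0 1 \<longrightarrow> x \<noteq> 0 \<longrightarrow> (AE r in lborel. (r, span {x}) \<notin> S)"
    by (subst (asm) AE_uniform_lines_iff[OF null_fibres])
  then have "AE x in lborel. AE s in lborel. x \<in> ball 0 1 \<longrightarrow> s *\<^sub>R x \<notin> E"
    using AE_lborel_singleton[of 0]
  proof eventually_elim
    case (elim x)
    show ?case
    proof (cases "x \<in> ball 0 1")
      case True
      define c where "c = x \<bullet> u (span {x})"
      have x: "x = c *\<^sub>R u (span {x})"
        using scaleR_inner_direction[OF span_in_lines, of x x] elim(2) by (simp add: c_def span_base)
      then have c: "c \<noteq> 0" using elim(2) by auto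
      have "AE r in lborel. (r, span {x}) \<notin> S" using elim True by auto
      \<comment> \<open>Since \<open>x\<close> is \<open>c\<close> times the unit direction, the
        substitution \<open>r = c * s\<close> turns almost every signed distance into almost every
        parameter \<open>s\<close>.\<close>
      then have "AE s in lborel. (0 + c * s, span {x}) \<notin> S"
        using span_in_lines[OF elim(2)] by (intro AE_borel_affine[OF c]) measurable
      then show ?thesis
        using AE_lborel_singleton[of 0]
      proof eventually_elim
        case (elim s)
        have "s *\<^sub>R x = (c * s) *\<^sub>R u (span {x})"
          by (subst x) simp
        moreover have "coords ((c * s) *\<^sub>R u (span {x})) = (c * s, span {x})"
          using coords_polar[OF span_in_lines, of x "c * s"] c elim \<open>x \<noteq> 0\<close> by simp
        ultimately show ?case using elim by (simp add: E_def)
      qed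
    qed simp
  qed
  then have AE_s: "AE s in lborel. AE x in lborel. x \<in> ball 0 1 \<longrightarrow> s *\<^sub>R x \<notin> E"
    by (subst (asm) lborel_pair.AE_commute[OF dilation])
  have "AE x in lborel. x \<in> ball 0 (real n) \<longrightarrow> x \<notin> E" for n
  proof -
    \<comment> \<open>The good factors have full measure, so one of them lies in (n, n + 1);
      dilating the unit ball by it covers the ball of radius \<open>n\<close>.\<close>
    have "\<not> (AE s in lborel. s \<notin> {real n<..<real n + 1})"
      by (subst AE_iff_null_sets[symmetric]) (simp_all add: null_sets_def)
    then obtain s where s: "real n < s" "AE x in lborel. x \<in> ball 0 1 \<longrightarrow> s *\<^sub>R x \<notin> E"
      using AE_s by (metis (mono_tags, lifting) eventually_mono greaterThanLessThan_iff)
    from s(2) have "AE x in lborel. s *\<^sub>R x \<in> ball 0 (real n) \<longrightarrow> s *\<^sub>R x \<notin> E"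
    proof eventually_elim
      case (elim x)
      show ?case
      proof
        assume "s *\<^sub>R x \<in> ball 0 (real n)"
        then have "s * norm x < real n" using s(1) by simp
        then have "s * norm x < s * 1" using s(1) by linarith
        moreover have "0 < s" using s(1) of_nat_0_le_iff[of n] by linarith
        ultimately have "norm x < 1" by (simp only: mult_less_cancel_left_pos)
        with elim show "s *\<^sub>R x \<notin> E" by simp
      qed
    qed
    moreover have "s \<noteq> 0" using s(1) by auto
    moreover have "Measurable.pred borel (\<lambda>x. x \<in> ball 0 (real n) \<longrightarrow> x \<notin> E)"
    proof -
      have "- (ball 0 (real n) \<inter> E) \<in> sets borel" using E by simp
      moreover have "- (ball 0 (real n) \<inter> E) = {x. x \<in> ball 0 (real n) \<longrightarrow> x \<notin> E}" by auto
      ultimately show ?thesis by (simp only: pred_def space_borel UNIV_I simp_thms)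
    qed
    ultimately show ?thesis
      by (rule AE_lborel_scaleR[rotated 2])
  qed
  then have "AE x in lborel. \<forall>n. x \<in> ball 0 (real n) \<longrightarrow> x \<notin> E"
    by (subst AE_all_countable) auto
  then show ?thesis
  proof eventually_elim
    case (elim x)
    obtain n where "norm x < real n" using reals_Archimedean2 by blast
    with elim have "x \<notin> E" by auto
    then show ?case by (simp add: E_def)
  qed
qed

text \<open>The density is that of the law of \<open>coords\<close> under \<rho>: a null set for dr
  d\<theta> pulls back to a Lebesgue null set, hence to a \<rho>-null set. Pushing this law forward
  by \<open>polar\<close> returns \<rho>, as \<open>polar\<close> undoes
  \<open>coords\<close>.\<close>

lemma polar_density_exists:
  assumes "absolutely_continuous lborel \<rho>" and [measurable_cong]: "sets \<rho> = sets borel"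
  shows "\<exists>g. polar_density u \<rho> g"
proof -
  interpret U: prob_space "uniform_lines :: 'a set measure" by (rule prob_space_uniform_lines)
  interpret P: pair_sigma_finite "lborel :: real measure" "uniform_lines :: 'a set measure" ..
  have [measurable]: "coords \<in> \<rho> \<rightarrow>\<^sub>M polar_measure"
    by (subst measurable_cong_sets[OF assms(2) refl]) (rule coords_measurable_polar)
  let ?\<nu> = "distr \<rho> polar_measure coords"
  have "absolutely_continuous polar_measure ?\<nu>"
    unfolding absolutely_continuous_def
  proof
    fix S assume S: "S \<in> null_sets polar_measure"
    then have [measurable]: "S \<in> sets polar_measure" by auto
    have "{x. coords x \<in> S} \<in> null_sets lborel"
      using AE_coords_notin_null_set[OF S] by (subst (asm) AE_iff_null) auto
    then have "{x. coords x \<in> S} \<in> null_sets \<rho>"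
      using assms(1) by (auto simp: absolutely_continuous_def)
    moreover have "coords -` S \<inter> space \<rho> = {x. coords x \<in> S}"
      using sets_eq_imp_space_eq[OF assms(2)] by auto
    ultimately show "S \<in> null_sets ?\<nu>"
      using \<open>S \<in> sets polar_measure\<close>
      by (intro null_setsI) (simp_all add: emeasure_distr null_setsD1 del: sets_uniform_lines)
  qed
  then obtain g where g[measurable]: "g \<in> borel_measurable polar_measure" "density polar_measure g = ?\<nu>"
    using P.Radon_Nikodym[of ?\<nu>] by auto
  have "distr ?\<nu> borel polar = distr \<rho> borel (\<lambda>x. x)"
    by (subst distr_distr) (auto simp: comp_def polar_coords intro!: distr_cong)
  also have "\<dots> = \<rho>"
    by (rule distr_id2) (simp add: assms)
  finally show ?thesis
    unfolding polar_density_def by (intro exI[of _ g]) (rule conjI, rule g(1), simp only: g(2))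
qed

section \<open>Gluing the cyclic maps of the lines\<close>

context
  fixes g :: "real \<times> 'a set \<Rightarrow> ennreal"
  assumes g [measurable]: "g \<in> borel_measurable polar_measure"
begin

definition line_mass :: "'a set \<Rightarrow> ennreal" where
  "line_mass \<theta> = (\<integral>\<^sup>+ r. g (r, \<theta>) \<partial>lborel)"

definition line_measure :: "'a set \<Rightarrow> real measure" where
  "line_measure \<theta> = density lborel (\<lambda>r. g (r, \<theta>))"

lemma section_measurable [measurable]:
  assumes "\<theta> \<in> lines"
  shows "(\<lambda>r. g (r, \<theta>)) \<in> borel_measurable borel"
  using assms by (intro measurable_compose[OF _ g]) auto

lemma line_mass_measurable [measurable]: "line_mass \<in> borel_measurable line_algebra"
proof -
  have "(\<lambda>(\<theta>, r). g (r, \<theta>)) \<in> borel_measurable (uniform_lines \<Otimes>\<^sub>M lborel)"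
    by measurable
  then have "line_mass \<in> borel_measurable uniform_lines"
    unfolding line_mass_def by (intro lborel.borel_measurable_nn_integral)
  then show ?thesis
    by (simp add: measurable_cong_sets[OF sets_uniform_lines refl])
qed

lemma atomless_line_measure:
  assumes "\<theta> \<in> lines" "line_mass \<theta> \<noteq> \<infinity>"
  shows "atomless_real_measure (line_measure \<theta>)"
  using assms unfolding line_measure_def line_mass_def
  by (intro atomless_real_measure_density) auto

lemma measure_line_measure_UNIV:
  "\<theta> \<in> lines \<Longrightarrow> measure (line_measure \<theta>) UNIV = enn2real (line_mass \<theta>)"
  by (simp add: line_measure_def line_mass_def measure_density_UNIV)

text \<open>The value is an integral over \<open>r\<close> of a function jointly measurable in
  \<open>x\<close> and \<open>r\<close>. The bound may vary with \<open>x\<close> so as to cover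
  both the level of the point itself and the level of a fixed threshold.\<close>

lemma cdf_line_measure_measurable [measurable]:
  assumes "f \<in> borel_measurable polar_measure"
  shows "(\<lambda>x. cdf (line_measure (snd x)) (f x)) \<in> borel_measurable polar_measure"
proof -
  note [measurable] = assms
  have "(\<lambda>(x, r). g (r, snd x) * (if r \<le> f x then 1 else 0)) \<in> borel_measurable (polar_measure \<Otimes>\<^sub>M lborel)"
    by measurable
  then have [measurable]: "(\<lambda>x. \<integral>\<^sup>+ r. g (r, snd x) * (if r \<le> f x then 1 else 0) \<partial>lborel) \<in> borel_measurable polar_measure"
    by (rule lborel.borel_measurable_nn_integral)
  have "(\<lambda>x. enn2real (\<integral>\<^sup>+ r. g (r, snd x) * (if r \<le> f x then 1 else 0) \<partial>lborel)) \<in> borel_measurable polar_measure"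
    by measurable
  moreover have "cdf (line_measure (snd x)) (f x)
      = enn2real (\<integral>\<^sup>+ r. g (r, snd x) * (if r \<le> f x then 1 else 0) \<partial>lborel)"
    if "x \<in> space polar_measure" for x
    using that unfolding cdf_def line_measure_def measure_def
    by (subst emeasure_density)
      (auto simp: space_pair_measure intro!: arg_cong[where f=enn2real] nn_integral_cong split: split_indicator)
  ultimately show ?thesis
    by (subst measurable_cong)
qed

lemma measurable_line_cyclic_map_exists:
  assumes m: "m \<in> {1..N}"
  shows "\<exists>F \<in> borel_measurable polar_measure. \<forall>\<theta>\<in>lines. line_mass \<theta> \<noteq> \<infinity> \<longrightarrow> line_mass \<theta> > 0 \<longrightarrow>
    cyclic_map (line_measure \<theta>) N m (\<lambda>r. F (r, \<theta>))"
proof -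
  define M where "M x = enn2real (line_mass (snd x))" for x :: "real \<times> 'a set"
  define S where "S x = rotate (M x) (real (m - 1) * (M x / real N)) (cdf (line_measure (snd x)) (fst x))" for x
  \<comment> \<open>This is where the quantile is meaningful; the default 0 elsewhere is harmless,
    as \<open>cyclic_map_quantile\<close> asks nothing there.\<close>
  define good where "good x \<longleftrightarrow> line_mass (snd x) \<noteq> \<infinity> \<and> 0 < S x \<and> S x < M x" for x
  define F where "F x = (if good x then quantile (line_measure (snd x)) (S x) else 0)" for x
  have [measurable]: "(\<lambda>x. line_mass (snd x)) \<in> borel_measurable polar_measure"
    by (rule measurable_compose[OF measurable_snd]) (simp add: measurable_cong_sets[OF sets_uniform_lines refl])
  have [measurable]: "M \<in> borel_measurable polar_measure"
    unfolding M_def by measurable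
  have [measurable]: "S \<in> borel_measurable polar_measure"
    unfolding S_def by measurable
  have [measurable]: "Measurable.pred polar_measure good"
    unfolding good_def by measurable
  \<comment> \<open>Sublevel sets of \<open>F\<close> become comparisons of jointly measurable
    functions.\<close>
  have le_iff: "F x \<le> a \<longleftrightarrow> (if good x then S x \<le> cdf (line_measure (snd x)) a else 0 \<le> a)"
    if x: "x \<in> space polar_measure" for x a
  proof (cases "good x")
    case True
    have \<theta>: "snd x \<in> lines" using x by (auto simp: space_pair_measure)
    interpret atomless_real_measure "line_measure (snd x)"
      using True \<theta> by (intro atomless_line_measure) (auto simp: good_def)
    show ?thesis
      using True quantile_le_iff[of "S x" a] measure_line_measure_UNIV[OF \<theta>]
      by (simp add: F_def good_def M_def)
  qed (simp add: F_def)
  have "F \<in> borel_measurable polar_measure"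
  proof (subst borel_measurable_iff_le, intro allI)
    fix a
    have "{x \<in> space polar_measure. if good x then S x \<le> cdf (line_measure (snd x)) a else 0 \<le> a}
        \<in> sets polar_measure"
      by measurable
    moreover have "{x \<in> space polar_measure. F x \<le> a}
        = {x \<in> space polar_measure. if good x then S x \<le> cdf (line_measure (snd x)) a else 0 \<le> a}"
      by (intro Collect_cong conj_cong refl le_iff)
    ultimately show "{x \<in> space polar_measure. F x \<le> a} \<in> sets polar_measure"
      by (simp only:)
  qed
  moreover have "cyclic_map (line_measure \<theta>) N m (\<lambda>r. F (r, \<theta>))"
    if \<theta>: "\<theta> \<in> lines" and fin: "line_mass \<theta> \<noteq> \<infinity>" and pos: "line_mass \<theta> > 0" for \<theta>
  proof -
    interpret atomless_real_measure "line_measure \<theta>"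
      using \<theta> fin by (rule atomless_line_measure)
    note M = measure_line_measure_UNIV[OF \<theta>]
    show ?thesis
    proof (rule cyclic_map_quantile[OF _ m])
      show "0 < measure (line_measure \<theta>) UNIV"
        using fin pos by (simp add: M enn2real_positive_iff top.not_eq_extremum)
    qed (auto simp: F_def good_def S_def M_def M fin)
  qed
  ultimately show ?thesis by blast
qed

text \<open>By Tonelli the line masses integrate to the total mass, which is finite.\<close>

lemma AE_line_mass_finite:
  assumes "finite_measure (density polar_measure g)"
  shows "AE \<theta> in uniform_lines. line_mass \<theta> \<noteq> \<infinity>"
proof -
  interpret U: prob_space "uniform_lines :: 'a set measure" by (rule prob_space_uniform_lines)
  interpret P: pair_sigma_finite "lborel :: real measure" "uniform_lines :: 'a set measure" ..
  have "(\<integral>\<^sup>+ \<theta>. line_mass \<theta> \<partial>uniform_lines) = emeasure (density polar_measure g) (space (density polar_measure g))"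
    unfolding line_mass_def P.nn_integral_snd[OF g] space_density emeasure_density[OF g sets.top]
    by (intro nn_integral_cong) (simp only: indicator_simps mult_1_right)
  also have "\<dots> \<noteq> \<infinity>"
    using assms by (simp add: finite_measure.emeasure_finite)
  finally show ?thesis
    by (intro nn_integral_PInf_AE) (simp_all add: measurable_cong_sets[OF sets_uniform_lines refl])
qed

text \<open>This is invariance on one line, tested against functions; \<open>h\<close> will be the
  indicator of the trace of a Borel set on the line. On a line of mass zero both integrals
  vanish.\<close>

lemma nn_integral_cyclic_map:
  assumes m: "m \<in> {1..N}"
    and F [measurable]: "F \<in> borel_measurable polar_measure"
    and \<theta>: "\<theta> \<in> lines" "line_mass \<theta> \<noteq> \<infinity>"
    and cyc: "line_mass \<theta> > 0 \<Longrightarrow> cyclic_map (line_measure \<theta>) N m (\<lambda>r. F (r, \<theta>))"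
    and h [measurable]: "h \<in> borel_measurable borel"
  shows "(\<integral>\<^sup>+ r. g (r, \<theta>) * h (F (r, \<theta>)) \<partial>lborel) = (\<integral>\<^sup>+ r. g (r, \<theta>) * h r \<partial>lborel)"
proof (cases "line_mass \<theta> = 0")
  case True
  then have "AE r in lborel. g (r, \<theta>) = 0"
    using \<theta> unfolding line_mass_def by (subst (asm) nn_integral_0_iff_AE) auto
  then show ?thesis
    by (intro nn_integral_cong_AE) auto
next
  case False
  interpret atomless_real_measure "line_measure \<theta>"
    using \<theta> by (rule atomless_line_measure)
  have sec [measurable]: "(\<lambda>r. F (r, \<theta>)) \<in> borel_measurable borel"
    using \<theta> by (intro measurable_compose[OF _ F]) auto
  have "0 < measure (line_measure \<theta>) UNIV"
    using False \<theta>(2)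
    by (simp add: measure_line_measure_UNIV[OF \<theta>(1)] enn2real_positive_iff top.not_eq_extremum zero_less_iff_neq_zero)
  then have dist: "distr (line_measure \<theta>) borel (\<lambda>r. F (r, \<theta>)) = line_measure \<theta>"
    using False cyc m by (intro distr_cyclic_map) (auto simp: zero_less_iff_neq_zero)
  have "(\<integral>\<^sup>+ r. g (r, \<theta>) * h (F (r, \<theta>)) \<partial>lborel) = (\<integral>\<^sup>+ r. h (F (r, \<theta>)) \<partial>line_measure \<theta>)"
    using \<theta> unfolding line_measure_def by (subst nn_integral_density) auto
  also have "\<dots> = (\<integral>\<^sup>+ r. h r \<partial>distr (line_measure \<theta>) borel (\<lambda>r. F (r, \<theta>)))"
    by (subst nn_integral_distr) auto
  also have "\<dots> = (\<integral>\<^sup>+ r. h r \<partial>line_measure \<theta>)"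
    by (simp only: dist)
  also have "\<dots> = (\<integral>\<^sup>+ r. g (r, \<theta>) * h r \<partial>lborel)"
    using \<theta> unfolding line_measure_def by (subst nn_integral_density) auto
  finally show ?thesis .
qed

end

section \<open>From the lines to the whole space\<close>

lemma finite_density_polar:
  assumes "prob_space \<rho>" "polar_density u \<rho> g"
  shows "finite_measure (density polar_measure g)"
proof -
  have "emeasure \<rho> (space \<rho>) = emeasure (density polar_measure g) (space polar_measure)"
    using assms(2) by (subst (1 2) conjunct2[OF assms(2)[unfolded polar_density_def], symmetric])
      (subst emeasure_distr, auto)
  then show ?thesis
    using prob_space.emeasure_space_1[OF assms(1)] by (intro finite_measureI) auto
qed

lemma line_cyclic_map_exists:
  assumes "m \<in> {1..N}" "prob_space \<rho>" "absolutely_continuous lborel \<rho>" "sets \<rho> = sets borel"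
  shows "\<exists>T. line_cyclic_map u \<rho> N m T"
proof -
  obtain g where g: "polar_density u \<rho> g"
    using polar_density_exists assms by blast
  then have gm: "g \<in> borel_measurable polar_measure"
    by (simp add: polar_density_def)
  obtain F where F: "F \<in> borel_measurable polar_measure"
    "\<And>\<theta>. \<theta> \<in> lines \<Longrightarrow> line_mass g \<theta> \<noteq> \<infinity> \<Longrightarrow> line_mass g \<theta> > 0 \<Longrightarrow>
      cyclic_map (line_measure g \<theta>) N m (\<lambda>r. F (r, \<theta>))"
    using measurable_line_cyclic_map_exists[OF gm assms(1)] by blast
  have "AE \<theta> in uniform_lines. line_mass g \<theta> > 0 \<longrightarrow> cyclic_map (line_measure g \<theta>) N m (\<lambda>r. F (r, \<theta>))"
    using AE_line_mass_finite[OF gm finite_density_polar[OF assms(2) g]] AE_space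
    by eventually_elim (auto intro: F)
  then have "line_cyclic_map u \<rho> N m (\<lambda>x. F (coords x) *\<^sub>R u (snd (coords x)))"
    unfolding line_cyclic_map_def using g F(1)
    by (intro exI[of _ g] exI[of _ F]) (auto simp: coords_polar line_mass_def[OF gm] line_measure_def[OF gm])
  then show ?thesis by blast
qed

lemma line_cyclic_map_preserves:
  assumes m: "m \<in> {1..N}" and \<rho>: "prob_space \<rho>" and [measurable_cong]: "sets \<rho> = sets borel"
    and T: "line_cyclic_map u \<rho> N m T"
  shows "T \<in> borel \<rightarrow>\<^sub>M borel" "distr \<rho> borel T = \<rho>"
proof -
  interpret U: prob_space "uniform_lines :: 'a set measure" by (rule prob_space_uniform_lines)
  interpret P: pair_sigma_finite "lborel :: real measure" "uniform_lines :: 'a set measure" ..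
  obtain g F where g: "polar_density u \<rho> g"
    and F [measurable]: "F \<in> borel_measurable polar_measure"
    and cyc: "AE \<theta> in uniform_lines. (\<integral>\<^sup>+ r. g (r, \<theta>) \<partial>lborel) > 0 \<longrightarrow>
        cyclic_map (density lborel (\<lambda>r. g (r, \<theta>))) N m (\<lambda>r. F (r, \<theta>))"
    and TF: "\<And>\<theta> r. \<theta> \<in> lines \<Longrightarrow> r \<noteq> 0 \<Longrightarrow> T (r *\<^sub>R u \<theta>) = F (r, \<theta>) *\<^sub>R u \<theta>"
    using T unfolding line_cyclic_map_def by blast
  from g have gm [measurable]: "g \<in> borel_measurable polar_measure"
    and \<rho>_eq: "distr (density polar_measure g) borel polar = \<rho>"
    by (auto simp: polar_density_def)
  \<comment> \<open>\<open>T\<close> is fixed by \<open>F\<close> except at the origin, and a free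
    value at a single point does not affect measurability.\<close>
  have "T x = (if x = 0 then T 0 else F (coords x) *\<^sub>R u (snd (coords x)))" for x
  proof (cases "x = 0")
    case False
    have x: "(x \<bullet> u (span {x})) *\<^sub>R u (span {x}) = x"
      using False by (intro scaleR_inner_direction span_in_lines) (auto simp: span_base)
    then have "x \<bullet> u (span {x}) \<noteq> 0" using False by force
    then have "T ((x \<bullet> u (span {x})) *\<^sub>R u (span {x})) = F (coords x) *\<^sub>R u (snd (coords x))"
      using False by (subst TF) (auto simp: span_in_lines coords_def)
    with False show ?thesis unfolding x by simp
  qed simp
  then have T_eq: "T = (\<lambda>x. if x = 0 then T 0 else F (coords x) *\<^sub>R u (snd (coords x)))"
    by (rule ext)
  show T_meas [measurable]: "T \<in> borel \<rightarrow>\<^sub>M borel"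
    by (subst T_eq) measurable
  show "distr \<rho> borel T = \<rho>"
  proof (rule measure_eqI)
    fix A assume "A \<in> sets (distr \<rho> borel T)"
    then have A [measurable]: "A \<in> sets borel" by simp
    \<comment> \<open>A general \<open>f\<close> is allowed so that \<open>T\<close> and the
      identity give iterated integrals of the same form, to be compared line by line.\<close>
    have int: "emeasure (distr \<rho> borel f) A
        = (\<integral>\<^sup>+ \<theta>. (\<integral>\<^sup>+ r. g (r, \<theta>) * indicator A (f (r *\<^sub>R u \<theta>)) \<partial>lborel) \<partial>uniform_lines)"
      if [measurable]: "f \<in> borel \<rightarrow>\<^sub>M borel" for f
    proof -
      have "emeasure (distr \<rho> borel f) A = (\<integral>\<^sup>+ x. indicator A x \<partial>distr \<rho> borel f)"
        by simp
      also have "\<dots> = (\<integral>\<^sup>+ x. indicator A (f x) \<partial>\<rho>)"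
        by (subst nn_integral_distr) auto
      also have "\<dots> = (\<integral>\<^sup>+ x. g x * indicator A (f (polar x)) \<partial>polar_measure)"
        by (subst \<rho>_eq[symmetric]) (simp add: nn_integral_distr nn_integral_density)
      also have "\<dots> = (\<integral>\<^sup>+ \<theta>. (\<integral>\<^sup>+ r. g (r, \<theta>) * indicator A (f (r *\<^sub>R u \<theta>)) \<partial>lborel) \<partial>uniform_lines)"
        by (subst P.nn_integral_snd[symmetric]) simp_all
      finally show ?thesis .
    qed
    have "emeasure (distr \<rho> borel T) A = emeasure (distr \<rho> borel (\<lambda>x. x)) A"
      unfolding int[OF T_meas] int[OF measurable_ident_sets[OF refl]]
    proof (intro nn_integral_cong_AE)
      show "AE \<theta> in uniform_lines. (\<integral>\<^sup>+ r. g (r, \<theta>) * indicator A (T (r *\<^sub>R u \<theta>)) \<partial>lborel)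
          = (\<integral>\<^sup>+ r. g (r, \<theta>) * indicator A (r *\<^sub>R u \<theta>) \<partial>lborel)"
        using cyc AE_line_mass_finite[OF gm finite_density_polar[OF \<rho> g]] AE_space
      proof eventually_elim
        case (elim \<theta>)
        then have \<theta>: "\<theta> \<in> lines" by simp
        have "(\<integral>\<^sup>+ r. g (r, \<theta>) * indicator A (T (r *\<^sub>R u \<theta>)) \<partial>lborel)
            = (\<integral>\<^sup>+ r. g (r, \<theta>) * indicator A (F (r, \<theta>) *\<^sub>R u \<theta>) \<partial>lborel)"
          using AE_lborel_singleton[of 0]
          by (intro nn_integral_cong_AE) (auto simp: TF \<theta> elim!: eventually_mono)
        also have "\<dots> = (\<integral>\<^sup>+ r. g (r, \<theta>) * indicator A (r *\<^sub>R u \<theta>) \<partial>lborel)"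
          using elim \<theta>
          by (intro nn_integral_cyclic_map[OF gm m F, where h = "\<lambda>r. indicator A (r *\<^sub>R u \<theta>)"])
            (auto simp: line_mass_def[OF gm] line_measure_def[OF gm])
        finally show ?case .
      qed
    qed
    also have "distr \<rho> borel (\<lambda>x. x) = \<rho>"
      by (rule distr_id2) (simp add: assms)
    finally show "emeasure (distr \<rho> borel T) A = emeasure \<rho> A" .
  qed (simp add: assms)
qed

end

theorem proposition2p2p1:
  fixes \<rho> :: "'a::euclidean_space measure" and u :: "'a set \<Rightarrow> 'a" and N m :: nat
  assumes "N \<ge> 2"
    and "m \<in> {1..N}"
    and "prob_space \<rho>"
    and "sets \<rho> = sets borel"
    and "absolutely_continuous lborel \<rho>"
    and "direction_choice u"
  shows "(\<exists>T. line_cyclic_map u \<rho> N m T) \<and>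
    (\<forall>T. line_cyclic_map u \<rho> N m T \<longrightarrow> T \<in> borel \<rightarrow>\<^sub>M borel \<and> distr \<rho> borel T = \<rho>)"
proof -
  interpret line_directions u
    using assms(6) by unfold_locales
  show ?thesis
    using line_cyclic_map_exists[OF assms(2,3,5,4)] line_cyclic_map_preserves[OF assms(2,3,4)] by blast
qed

end
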